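(* Let $p\in\mathbb{R}$. The inequality $N(a,b)<He_p(a,b)$ holds for all $a,b>0$ with $a\neq b$ if and only if $p\ge 2$.
   Context: For $a,b>0$ with $a\ne b$ the Neuman-Sándor mean is $N(a,b)=\dfrac{a-b}{2\,\mathrm{arcsinh}\frac{a-b}{a+b}}$, with $N(a,a)=a$. For $a,b>0$ the Heronian mean is $He(a,b)=\dfrac{a+b+\sqrt{ab}}{3}$. For $p\in\mathbb{R}$, $He_p(a,b)=\left(He(a^p,b^p)\right)^{1/p}$ if $p\neq0$ and $He_0(a,b)=\sqrt{ab}$. *)

theory Defs
  imports Complex_Main
begin

definition neuman_sandor_mean :: "real \<Rightarrow> real \<Rightarrow> real" where
  "neuman_sandor_mean a b =
     (if a = b then a else (a - b) / (2 * arsinh ((a - b) / (a + b))))"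

definition heronian_mean :: "real \<Rightarrow> real \<Rightarrow> real" where
  "heronian_mean a b = (a + b + sqrt (a * b)) / 3"

definition heronian_power_mean :: "real \<Rightarrow> real \<Rightarrow> real \<Rightarrow> real" where
  "heronian_power_mean p a b =
     (if p = 0 then sqrt (a * b)
      else heronian_mean (a powr p) (b powr p) powr (1 / p))"

end

theory Submission
  imports Defs "HOL-Analysis.Convex" "HOL-Real_Asymp.Real_Asymp"
begin

text \<open>
  Both halves rest on the value \<open>p = 2\<close> being the exact second-order match of the two means on the
  diagonal.

  Sufficiency. By homogeneity, put \<open>x = (a - b) / (a + b)\<close>. Dividing by \<open>(a + b) / 2\<close> turns the
  Neuman-Sandor mean into \<open>x / arsinh x\<close> and the Heronian mean of order 2 into
  \<open>sqrt (1 + x\<^sup>2 / 3)\<close>, so the case \<open>p = 2\<close> says \<open>x / sqrt (1 + x\<^sup>2 / 3) < arsinh x\<close> for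
  \<open>x > 0\<close>. Both sides vanish at 0, and the derivatives are \<open>(1 + x\<^sup>2 / 3) powr (-3/2)\<close> and
  \<open>(1 + x\<^sup>2) powr (-1/2)\<close>, which compare correctly because \<open>(1 + x\<^sup>2 / 3)\<^sup>3 > 1 + x\<^sup>2\<close>
  (\<open>div_sqrt_less_arsinh\<close>). For larger \<open>p\<close>, the Heronian mean of order \<open>p\<close> is the ordinary power
  mean of order \<open>p\<close> of the three numbers \<open>a\<close>, \<open>b\<close> and \<open>sqrt (a * b)\<close>; power means grow with
  their order by Jensen's inequality (\<open>heronian_power_mean_2_le\<close>).

  Necessity. On the curve \<open>a = exp t\<close>, \<open>b = exp (- t)\<close> both means tend to 1 as \<open>t\<close> decreases to
  0. The logarithm of the Heronian mean of order \<open>p\<close> is \<open>(p / 3) * t\<^sup>2 + o(t\<^sup>2)\<close>, and that of the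
  Neuman-Sandor mean is \<open>(2 / 3) * t\<^sup>2 + o(t\<^sup>2)\<close>. The inequality therefore forces
  \<open>2 / 3 \<le> p / 3\<close>. On this curve all \<open>p \<noteq> 0\<close> reduce to one limit, as \<open>p\<close>
  enters only through \<open>cosh (p * t)\<close> and a factor \<open>1 / p\<close>; for \<open>p = 0\<close> the mean is constantly 1.
\<close>

section \<open>The bound by the Heronian mean of order 2\<close>

text \<open>
  The difference of the two sides vanishes at 0 and is strictly increasing: with
  \<open>w = 1 + t\<^sup>2 / 3\<close> its derivative is \<open>1 / sqrt (t\<^sup>2 + 1) - 1 / sqrt (w ^ 3)\<close>, and expanding
  \<open>w ^ 3\<close> gives \<open>1 + t\<^sup>2\<close> plus positive terms. The two derivatives agree up to terms of
  order \<open>t ^ 4\<close>, so the constant 3 cannot be increased.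
\<close>
lemma div_sqrt_less_arsinh:
  fixes x :: real
  assumes "x > 0"
  shows "x / sqrt (1 + x\<^sup>2 / 3) < arsinh x"
proof -
  define f where "f = (\<lambda>t::real. arsinh t - t / sqrt (1 + t\<^sup>2 / 3))"
  have f': "\<exists>y. DERIV f t :> y \<and> y > 0" if "t > 0" for t
  proof -
    define w where "w = 1 + t\<^sup>2 / 3"
    have w: "w > 0" unfolding w_def by (simp add: add_pos_nonneg)
    have "DERIV f t :> 1 / sqrt (t\<^sup>2 + 1) - (sqrt w - t * (2 * t / 3 * (inverse (sqrt w) / 2))) / w"
      unfolding f_def using w
      by (auto intro!: derivative_eq_intros simp: w_def power2_eq_square field_simps)
    moreover have "(sqrt w - t * (2 * t / 3 * (inverse (sqrt w) / 2))) / w = 1 / sqrt (w ^ 3)"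
    proof -
      have "sqrt w - t * (2 * t / 3 * (inverse (sqrt w) / 2)) = (w - t\<^sup>2 / 3) / sqrt w"
        using w by (simp add: field_simps power2_eq_square)
      also have "\<dots> = 1 / sqrt w"
        by (simp add: w_def)
      finally show ?thesis
        using w by (simp add: power3_eq_cube real_sqrt_mult)
    qed
    moreover have "1 / sqrt (w ^ 3) < 1 / sqrt (t\<^sup>2 + 1)"
    proof -
      have "w ^ 3 = 1 + t\<^sup>2 + (t\<^sup>2)\<^sup>2 / 3 + (t\<^sup>2) ^ 3 / 27"
        by (simp add: w_def power2_eq_square power3_eq_cube field_simps)
      then have "t\<^sup>2 + 1 < w ^ 3"
        using \<open>t > 0\<close> by (simp add: add_pos_pos)
      then show ?thesis
        by (intro divide_strict_left_mono mult_pos_pos) (auto simp: w add_nonneg_pos)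
    qed
    ultimately show ?thesis
      by (intro exI[of _ "1 / sqrt (t\<^sup>2 + 1) - 1 / sqrt (w ^ 3)"]) simp
  qed
  have "1 + t\<^sup>2 / 3 \<noteq> 0" for t :: real
    by (smt (verit) zero_le_power2 divide_nonneg_pos)
  then have "continuous_on {0..x} f"
    unfolding f_def by (intro continuous_intros) auto
  then have "f 0 < f x"
    by (intro DERIV_pos_imp_increasing_open[OF assms] f')
  then show ?thesis
    by (simp add: f_def)
qed

text \<open>
  Both sides are even in \<open>x\<close>, so the positive case suffices; the version for both signs spares a
  case distinction on which of the two arguments of the means is larger.
\<close>
lemma div_arsinh_less_sqrt:
  fixes x :: real
  assumes "x \<noteq> 0"
  shows "x / arsinh x < sqrt (1 + x\<^sup>2 / 3)"
proof -
  have pos: "y / arsinh y < sqrt (1 + y\<^sup>2 / 3)" if "y > 0" for y :: real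
  proof -
    have "sqrt (1 + y\<^sup>2 / 3) > 0"
      by (simp add: add_pos_nonneg)
    then show ?thesis
      using div_sqrt_less_arsinh[OF that] that by (simp add: field_simps)
  qed
  show ?thesis
    using pos[of x] pos[of "- x"] assms by (cases "x > 0") auto
qed

lemma neuman_sandor_mean_eq:
  fixes a b :: real
  assumes "a > 0" "b > 0" "a \<noteq> b"
  defines "x \<equiv> (a - b) / (a + b)"
  shows "neuman_sandor_mean a b = (a + b) / 2 * (x / arsinh x)"
proof -
  have "a - b = (a + b) * x"
    using assms(1,2) by (simp add: x_def)
  moreover have "neuman_sandor_mean a b = (a - b) / (2 * arsinh x)"
    using assms(3) by (simp add: neuman_sandor_mean_def x_def)
  ultimately show ?thesis
    by simp
qed

text \<open>
  Order 2 makes the geometric term polynomial: \<open>sqrt (a\<^sup>2 * b\<^sup>2) = a * b\<close>, and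
  \<open>(a\<^sup>2 + b\<^sup>2 + a * b) / 3 = (a + b)\<^sup>2 / 4 + (a - b)\<^sup>2 / 12\<close>.
\<close>
lemma heronian_power_mean_2:
  fixes a b :: real
  assumes "a > 0" "b > 0"
  shows "heronian_power_mean 2 a b = (a + b) / 2 * sqrt (1 + ((a - b) / (a + b))\<^sup>2 / 3)"
proof -
  have "sqrt (a powr 2 * b powr 2) = a * b"
    using assms by (simp add: real_sqrt_mult)
  then have "heronian_power_mean 2 a b = sqrt ((a\<^sup>2 + b\<^sup>2 + a * b) / 3)"
    using assms by (simp add: heronian_power_mean_def heronian_mean_def powr_half_sqrt)
  also have "(a\<^sup>2 + b\<^sup>2 + a * b) / 3 = ((a + b) / 2)\<^sup>2 * (1 + ((a - b) / (a + b))\<^sup>2 / 3)"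
  proof -
    have "a + b \<noteq> 0" using assms by simp
    then have "((a + b) / 2)\<^sup>2 * (1 + ((a - b) / (a + b))\<^sup>2 / 3) = (a + b)\<^sup>2 / 4 + (a - b)\<^sup>2 / 12"
      by (simp add: power_divide distrib_left)
    moreover have "(a\<^sup>2 + b\<^sup>2 + a * b) / 3 = (a + b)\<^sup>2 / 4 + (a - b)\<^sup>2 / 12"
      by (simp add: power2_eq_square field_simps)
    ultimately show ?thesis
      by simp
  qed
  also have "sqrt \<dots> = (a + b) / 2 * sqrt (1 + ((a - b) / (a + b))\<^sup>2 / 3)"
    using assms by (simp add: real_sqrt_mult)
  finally show ?thesis .
qed

section \<open>Monotonicity in the order\<close>

text \<open>
  Jensen's inequality for the convex function \<open>\<lambda>x. x powr q\<close> with equal weights.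
\<close>
lemma mean_powr_le:
  fixes y :: "'a \<Rightarrow> real"
  assumes "finite S" "S \<noteq> {}" "\<And>i. i \<in> S \<Longrightarrow> y i > 0" "q \<ge> 1"
  shows "((\<Sum>i\<in>S. y i) / card S) powr q \<le> (\<Sum>i\<in>S. y i powr q) / card S"
proof -
  have "card S > 0"
    using assms(1,2) by (simp add: card_gt_0_iff)
  then have "(\<Sum>i\<in>S. (1 / card S) *\<^sub>R y i) powr q \<le> (\<Sum>i\<in>S. 1 / card S * y i powr q)"
    using assms by (intro convex_on_sum[OF assms(1,2) powr_convex[OF assms(4)]]) auto
  then show ?thesis
    by (simp add: sum_divide_distrib)
qed

text \<open>
  Since \<open>sqrt (a powr p * b powr p) = (a * b) powr (p / 2)\<close>, both sides are power means of
  \<open>a\<close>, \<open>b\<close> and \<open>sqrt (a * b)\<close>. Jensen's inequality with exponent \<open>p / 2\<close>, applied to the squares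
  of these three numbers, compares the orders 2 and \<open>p\<close>.
\<close>
lemma heronian_power_mean_2_le:
  fixes a b p :: real
  assumes "a > 0" "b > 0" "p \<ge> 2"
  shows "heronian_power_mean 2 a b \<le> heronian_power_mean p a b"
proof -
  have sqrt_eq: "sqrt (a powr r * b powr r) = (a * b) powr (r / 2)" for r
    using assms by (simp add: powr_half_sqrt[symmetric] powr_mult powr_powr)
  define y where "y = (!) [a powr 2, b powr 2, a * b]"
  have y: "y i > 0" if "i \<in> {..<3}" for i
    using that assms by (auto simp: y_def less_Suc_eq numeral_3_eq_3)
  have mean_le: "((a powr 2 + b powr 2 + a * b) / 3) powr (p / 2)
      \<le> (a powr p + b powr p + (a * b) powr (p / 2)) / 3"
    using mean_powr_le[of "{..<3}" y "p / 2"] y assms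
    by (simp add: y_def numeral_3_eq_3 powr_powr lessThan_Suc add_ac del: powr_numeral)
  define m where "m = (a powr 2 + b powr 2 + a * b) / 3"
  have "heronian_power_mean 2 a b = m powr (1 / 2)"
    using sqrt_eq[of 2] assms
    by (simp add: heronian_power_mean_def heronian_mean_def m_def del: powr_numeral)
  also have "\<dots> = (m powr (p / 2)) powr (1 / p)"
    using assms by (simp add: powr_powr)
  also have "\<dots> \<le> ((a powr p + b powr p + (a * b) powr (p / 2)) / 3) powr (1 / p)"
    using mean_le assms by (intro powr_mono2) (auto simp: m_def)
  also have "\<dots> = heronian_power_mean p a b"
    using sqrt_eq[of p] assms by (simp add: heronian_power_mean_def heronian_mean_def)
  finally show ?thesis .
qed

lemma neuman_sandor_mean_less_heronian_power_mean:
  fixes a b p :: real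
  assumes "a > 0" "b > 0" "a \<noteq> b" "p \<ge> 2"
  shows "neuman_sandor_mean a b < heronian_power_mean p a b"
proof -
  have "neuman_sandor_mean a b < heronian_power_mean 2 a b"
    unfolding neuman_sandor_mean_eq[OF assms(1-3)] heronian_power_mean_2[OF assms(1,2)]
    using assms by (intro mult_strict_left_mono div_arsinh_less_sqrt) auto
  also have "\<dots> \<le> heronian_power_mean p a b"
    by (rule heronian_power_mean_2_le) (use assms in auto)
  finally show ?thesis .
qed

section \<open>Second-order behaviour near the diagonal\<close>

lemma neuman_sandor_mean_exp:
  fixes t :: real
  assumes "t > 0"
  shows "neuman_sandor_mean (exp t) (exp (- t)) = sinh t / arsinh (tanh t)"
proof -
  have s: "exp t - exp (- t) = 2 * sinh t"
    unfolding sinh_field_def by simp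
  have c: "exp t + exp (- t) = 2 * cosh t"
    unfolding cosh_field_def by simp
  have "exp t \<noteq> exp (- t)" using assms by simp
  then have "neuman_sandor_mean (exp t) (exp (- t)) = 2 * sinh t / (2 * arsinh (2 * sinh t / (2 * cosh t)))"
    by (simp only: neuman_sandor_mean_def s c if_False)
  moreover have "2 * sinh t / (2 * cosh t) = tanh t"
    by (simp only: tanh_def mult_divide_mult_cancel_left_if) simp
  ultimately show ?thesis
    by (simp only: mult_divide_mult_cancel_left_if) simp
qed

lemma ln_heronian_power_mean_exp:
  fixes p t :: real
  shows "ln (heronian_power_mean p (exp t) (exp (- t)))
    = (if p = 0 then 0 else ln ((2 * cosh (p * t) + 1) / 3) / p)"
proof -
  have "exp t powr p = exp (p * t)" "exp (- t) powr p = exp (- (p * t))"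
    by (simp_all add: powr_def)
  moreover have "2 * cosh (p * t) + 1 = exp (p * t) + exp (- (p * t)) + 1"
    by (simp add: cosh_def)
  ultimately show ?thesis
    by (simp add: heronian_power_mean_def heronian_mean_def exp_add[symmetric] ln_powr add_pos_pos)
qed

text \<open>
  The quotient splits as \<open>(sinh t / t) / ((arsinh y / y) * (tanh t / t))\<close> with \<open>y = tanh t\<close>. The
  second-order coefficients of the logarithms of the factors are \<open>1/6\<close>, \<open>-1/6\<close> and \<open>-1/3\<close>, where
  \<open>y\<close> may be replaced by \<open>t\<close> to this order, and \<open>1/6 + 1/6 + 1/3 = 2/3\<close>.
\<close>
lemma ln_neuman_sandor_mean_asymp:
  "((\<lambda>t::real. ln (sinh t / arsinh (tanh t)) / t\<^sup>2) \<longlongrightarrow> 2 / 3) (at_right 0)"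
proof -
  have sinh: "((\<lambda>t::real. ln (sinh t / t) / t\<^sup>2) \<longlongrightarrow> 1 / 6) (at_right 0)"
    by real_asymp
  have tanh: "((\<lambda>t::real. ln (tanh t / t) / t\<^sup>2) \<longlongrightarrow> - 1 / 3) (at_right 0)"
    by real_asymp
  have arsinh: "((\<lambda>y::real. ln (arsinh y / y) / y\<^sup>2) \<longlongrightarrow> - 1 / 6) (at_right 0)"
    unfolding arsinh_real_def by real_asymp
  have tanh_div: "((\<lambda>t::real. tanh t / t) \<longlongrightarrow> 1) (at_right 0)"
    by real_asymp
  have "filterlim tanh (at_right (0::real)) (at_right 0)"
    by real_asymp
  from filterlim_compose[OF arsinh this]
  have arsinh_tanh: "((\<lambda>t::real. ln (arsinh (tanh t) / tanh t) / (tanh t)\<^sup>2) \<longlongrightarrow> - 1 / 6) (at_right 0)" .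
  have "((\<lambda>t::real. ln (sinh t / t) / t\<^sup>2 - ln (tanh t / t) / t\<^sup>2
      - ln (arsinh (tanh t) / tanh t) / (tanh t)\<^sup>2 * (tanh t / t)\<^sup>2) \<longlongrightarrow> 1 / 6 - (- 1 / 3) - (- 1 / 6) * 1\<^sup>2)
      (at_right 0)"
    by (intro tendsto_diff tendsto_mult tendsto_power sinh tanh arsinh_tanh tanh_div)
  moreover have "ln (sinh t / t) / t\<^sup>2 - ln (tanh t / t) / t\<^sup>2
      - ln (arsinh (tanh t) / tanh t) / (tanh t)\<^sup>2 * (tanh t / t)\<^sup>2
      = ln (sinh t / arsinh (tanh t)) / t\<^sup>2" if "t > 0" for t :: real
  proof -
    have "ln (arsinh (tanh t) / tanh t) / (tanh t)\<^sup>2 * (tanh t / t)\<^sup>2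
        = ln (arsinh (tanh t) / tanh t) / t\<^sup>2"
      using that by (simp add: power_divide)
    then show ?thesis
      using that by (simp add: ln_div diff_divide_distrib)
  qed
  ultimately show ?thesis
    by (auto elim!: Lim_transform_eventually simp: eventually_at_filter)
qed

lemma ln_heronian_cosh_asymp:
  "((\<lambda>u::real. ln ((2 * cosh u + 1) / 3) / u\<^sup>2) \<longlongrightarrow> 1 / 3) (at 0)"
  by real_asymp

text \<open>
  Substituting \<open>u = p * t\<close> in \<open>ln_heronian_cosh_asymp\<close> multiplies its limit by \<open>p\<^sup>2\<close>, and the exponent
  \<open>1 / p\<close> of the mean removes one factor \<open>p\<close>. The limit for \<open>u\<close> is two-sided because \<open>p * t\<close>
  is negative for \<open>p < 0\<close>.
\<close>
lemma ln_heronian_power_mean_asymp: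
  fixes p :: real
  shows "((\<lambda>t. ln (heronian_power_mean p (exp t) (exp (- t))) / t\<^sup>2) \<longlongrightarrow> p / 3) (at_right 0)"
proof (cases "p = 0")
  case True
  then show ?thesis
    by (simp add: ln_heronian_power_mean_exp)
next
  case False
  have "filterlim (\<lambda>t. p * t) (at 0) (at_right 0)"
    unfolding filterlim_at
    using False by (auto intro!: tendsto_eq_intros simp: eventually_at_filter)
  from tendsto_mult[OF tendsto_const[of p] filterlim_compose[OF ln_heronian_cosh_asymp this]]
  have "((\<lambda>t. p * (ln ((2 * cosh (p * t) + 1) / 3) / (p * t)\<^sup>2)) \<longlongrightarrow> p / 3) (at_right 0)"
    by simp
  moreover have "p * (ln ((2 * cosh (p * t) + 1) / 3) / (p * t)\<^sup>2)
      = ln (heronian_power_mean p (exp t) (exp (- t))) / t\<^sup>2" for t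
    using False by (simp add: ln_heronian_power_mean_exp power2_eq_square)
  ultimately show ?thesis
    by simp
qed

lemma neuman_sandor_mean_exp_pos:
  fixes t :: real
  assumes "t > 0"
  shows "neuman_sandor_mean (exp t) (exp (- t)) > 0"
  unfolding neuman_sandor_mean_exp[OF assms] using assms by simp

text \<open>
  Comparing the leading coefficients \<open>2 / 3\<close> and \<open>p / 3\<close>. The strict inequality passes to a weak
  one in the limit, so the boundary value \<open>p = 2\<close> is not excluded.
\<close>
lemma two_le_of_neuman_sandor_mean_less:
  fixes p :: real
  assumes "\<And>t. t > 0 \<Longrightarrow>
    neuman_sandor_mean (exp t) (exp (- t)) < heronian_power_mean p (exp t) (exp (- t))"
  shows "p \<ge> 2"
proof -
  have "ln (sinh t / arsinh (tanh t)) / t\<^sup>2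
      \<le> ln (heronian_power_mean p (exp t) (exp (- t))) / t\<^sup>2" if "t > 0" for t
  proof -
    have "ln (neuman_sandor_mean (exp t) (exp (- t)))
        \<le> ln (heronian_power_mean p (exp t) (exp (- t)))"
      using assms[OF that] neuman_sandor_mean_exp_pos[OF that] by simp
    then show ?thesis
      using that by (simp add: neuman_sandor_mean_exp divide_right_mono)
  qed
  then have "\<forall>\<^sub>F t in at_right 0. ln (sinh t / arsinh (tanh t)) / t\<^sup>2
      \<le> ln (heronian_power_mean p (exp t) (exp (- t))) / t\<^sup>2"
    by (simp add: eventually_at_filter)
  then have "2 / 3 \<le> p / 3"
    by (intro tendsto_le[OF _ ln_heronian_power_mean_asymp ln_neuman_sandor_mean_asymp]) auto
  then show ?thesis
    by simp
qed

section \<open>The sharp order\<close>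

theorem theorem5:
  fixes p :: real
  shows "(\<forall>a b :: real. a > 0 \<and> b > 0 \<and> a \<noteq> b \<longrightarrow>
            neuman_sandor_mean a b < heronian_power_mean p a b) \<longleftrightarrow> p \<ge> 2"
proof
  assume less: "\<forall>a b :: real. a > 0 \<and> b > 0 \<and> a \<noteq> b \<longrightarrow>
            neuman_sandor_mean a b < heronian_power_mean p a b"
  have "neuman_sandor_mean (exp t) (exp (- t)) < heronian_power_mean p (exp t) (exp (- t))"
    if "t > 0" for t :: real
    using less that by simp
  then show "p \<ge> 2"
    by (rule two_le_of_neuman_sandor_mean_less)
next
  assume "p \<ge> 2"
  then show "\<forall>a b :: real. a > 0 \<and> b > 0 \<and> a \<noteq> b \<longrightarrow>
            neuman_sandor_mean a b < heronian_power_mean p a b"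
    by (blast intro: neuman_sandor_mean_less_heronian_power_mean)
qed

end
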